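(* Let $q\in\mathbb Z_{>0}$ be a composite number, let $D\ge1$ be an integer, and let $((\mathbb Z/q\mathbb Z)^{\mathbb Z^D},T)$ be a $D$-dimensional $q$-state linear cellular automaton. Then for any seeds $a,\hat a\in(\mathbb Z/q\mathbb Z)^{\times}$ (residue classes relatively prime to $q$), $$S_T(q,a)\cong S_T(q,\hat a),$$ i.e. the spatio-temporal patterns of the automaton from the single site seeds with $a$ and with $\hat a$ are isomorphic.
   Context: For an integer $n\ge 2$, $\mathbb Z/n\mathbb Z=\{0,1,\dots,n-1\}$ is the additive group of residue classes modulo $n$, and $(\mathbb Z/n\mathbb Z)^\times$ is the set of residue classes relatively prime to $n$. Linear cellular automaton: fix $D\ge1$, a positive integer $m$, integers $c_1,\dots,c_m\in\mathbb Z$ and vectors $\boldsymbol v_1,\dots,\boldsymbol v_m\in\mathbb Z^D$. The transition rule $T$ of the $D$-dimensional $n$-state linear cellular automaton $((\mathbb Z/n\mathbb Z)^{\mathbb Z^D},T)$ is $$(Tu)_{\boldsymbol i}=\sum_{j=1}^m c_j\,u_{\boldsymbol i+\boldsymbol v_j}\quad(\text{in }\mathbb Z/n\mathbb Z),\qquad u=\{u_{\boldsymbol i}\}_{\boldsymbol i\in\mathbb Z^D}\in(\mathbb Z/n\mathbb Z)^{\mathbb Z^D}.$$ Two linear cellular automata with different numbers of states $n,\hat n$ have the same transition rule $T$ if they are given by the same $m$, $c_j$, $\boldsymbol v_j$. $T^t$ is the $t$-fold composition of $T$, with $T^0u=u$. Single site seed: for $a\in(\mathbb Z/n\mathbb Z)\setminus\{0\}$,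 $u_{\langle a\rangle}\in(\mathbb Z/n\mathbb Z)^{\mathbb Z^D}$ is the configuration with $(u_{\langle a\rangle})_{\boldsymbol 0}=a$ and $(u_{\langle a\rangle})_{\boldsymbol i}=0$ for $\boldsymbol i\ne\boldsymbol 0$. The spatio-temporal pattern from it is $\{T^tu_{\langle a\rangle}\}_{t=0}^\infty$, computed in $(\mathbb Z/n\mathbb Z)^{\mathbb Z^D}$. Isomorphic patterns: let $\Delta_T(n,a)=\{b\in\mathbb Z/n\mathbb Z : \text{there exists }(\boldsymbol i,t)\in\mathbb Z^D\times\mathbb Z_{\ge0}\text{ with }(T^tu_{\langle a\rangle})_{\boldsymbol i}=b\}$. For $n,\hat n\ge2$, $a\in(\mathbb Z/n\mathbb Z)\setminus\{0\}$, $\hat a\in(\mathbb Z/\hat n\mathbb Z)\setminus\{0\}$ and automata with the same rule $T$, write $S_T(n,a)\cong S_T(\hat n,\hat a)$ if there is an isomorphism $f:\Delta_T(n,a)\to\Delta_T(\hat n,\hat a)$ such that $f\big((T^tu_{\langle a\rangle})_{\boldsymbol i}\big)=(T^tu_{\langle\hat a\rangle})_{\boldsymbol i}$ for all $\boldsymbol i\in\mathbb Z^D$ and $t\in\mathbb Z_{\ge0}$. Here "isomorphism" between these subsets means a bijection that is the restriction of a group isomorphism from the cyclic subgroup $\langle a\rangle\le\mathbb Z/n\mathbb Z$ generated by $a$ onto the cyclic subgroup $\langle\hat a\rangle\le\mathbb Z/\hat n\mathbb Z$ generated by $\hat a$ (note $\Delta_T(n,a)\subseteq\langle a\rangle$ and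 $\Delta_T(\hat n,\hat a)\subseteq\langle\hat a\rangle$). *)

theory Defs
  imports
    "HOL-Analysis.Finite_Cartesian_Product"
    "HOL-Algebra.Elementary_Groups"
    "HOL-Computational_Algebra.Primes"
begin

text \<open>
  Residue classes modulo \<open>n\<close> are the elements \<open>{0..<int n}\<close> of the group
  \<^const>\<open>integer_mod_group\<close>, so that automata with different numbers of states have
  configurations of the same HOL type. The lattice of cell positions is \<open>int ^ 'd\<close>,
  the dimension being \<open>CARD('d)\<close>. A transition rule is given by its number \<open>m\<close> of
  terms, its coefficients \<open>c 1, \<dots>, c m\<close> and its shift vectors \<open>v 1, \<dots>, v m\<close>; it does
  not depend on the number of states.
\<close>

type_synonym 'd configuration = "int ^ 'd \<Rightarrow> int"

definition lca_step ::
  "nat \<Rightarrow> nat \<Rightarrow> (nat \<Rightarrow> int) \<Rightarrow> (nat \<Rightarrow> int ^ 'd) \<Rightarrow> 'd::finite configuration \<Rightarrow> 'd configuration"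
  where "lca_step n m c v u = (\<lambda>i. (\<Sum>j = 1..m. c j * u (i + v j)) mod int n)"

definition single_site_seed :: "int \<Rightarrow> 'd::finite configuration"
  where "single_site_seed a = (\<lambda>i. if i = 0 then a else 0)"

definition lca_pattern ::
  "nat \<Rightarrow> (nat \<Rightarrow> int) \<Rightarrow> (nat \<Rightarrow> int ^ 'd) \<Rightarrow> nat \<Rightarrow> int \<Rightarrow> nat \<Rightarrow> 'd::finite configuration"
  where "lca_pattern m c v n a t = (lca_step n m c v ^^ t) (single_site_seed a)"

definition pattern_values ::
  "nat \<Rightarrow> (nat \<Rightarrow> int) \<Rightarrow> (nat \<Rightarrow> int ^ 'd::finite) \<Rightarrow> nat \<Rightarrow> int \<Rightarrow> int set"
  where "pattern_values m c v n a =
    {b \<in> carrier (integer_mod_group n). \<exists>i t. lca_pattern m c v n a t i = b}"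

text \<open>
  The notion is meant for \<open>n, n' \<ge> 2\<close> and nonzero residue classes \<open>a\<close> modulo \<open>n\<close> and
  \<open>a'\<close> modulo \<open>n'\<close>. Only the values of \<open>f\<close> on \<open>pattern_values m c v n a\<close> matter.
\<close>

definition isomorphic_patterns ::
  "nat \<Rightarrow> (nat \<Rightarrow> int) \<Rightarrow> (nat \<Rightarrow> int ^ 'd::finite) \<Rightarrow> nat \<Rightarrow> int \<Rightarrow> nat \<Rightarrow> int \<Rightarrow> bool"
  where "isomorphic_patterns m c v n a n' a' \<longleftrightarrow>
    (\<exists>f. bij_betw f (pattern_values m c v n a) (pattern_values m c v n' a') \<and>
         (\<exists>g \<in> iso (subgroup_generated (integer_mod_group n) {a})
                   (subgroup_generated (integer_mod_group n') {a'}).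
            \<forall>b \<in> pattern_values m c v n a. f b = g b) \<and>
         (\<forall>i t. f (lca_pattern m c v n a t i) = lca_pattern m c v n' a' t i))"

end

theory Submission
  imports Defs "HOL-Number_Theory.Cong"
begin

text \<open>
  If \<open>k\<close> is a unit modulo \<open>q\<close> with \<open>k a = a'\<close>, then multiplication by \<open>k\<close> is an automorphism of
  \<open>\<int>/q\<int>\<close>, the cyclic group generated by either seed. It commutes with the linear rule and maps
  one seed to the other, hence it maps one pattern to the other.
\<close>

lemma lca_step_mult:
  "lca_step n m c v (\<lambda>i. (k * u i) mod int n) = (\<lambda>i. (k * lca_step n m c v u i) mod int n)"
proof
  fix i
  have "(\<Sum>j = 1..m. c j * ((k * u (i + v j)) mod int n)) mod int n
      = (\<Sum>j = 1..m. (c j * (k * u (i + v j))) mod int n) mod int n"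
    \<comment> \<open>Each summand is first reduced modulo \<open>n\<close>, so that the reduction
      inside the factor can be absorbed.\<close>
    by (subst mod_sum_eq [symmetric]) (simp add: mod_mult_right_eq)
  also have "\<dots> = (k * (\<Sum>j = 1..m. c j * u (i + v j))) mod int n"
    by (simp add: mod_sum_eq sum_distrib_left mult.left_commute)
  finally show "lca_step n m c v (\<lambda>i. (k * u i) mod int n) i = (k * lca_step n m c v u i) mod int n"
    by (simp add: lca_step_def mod_mult_right_eq)
qed

lemma lca_pattern_mult:
  "lca_pattern m c v n ((k * a) mod int n) t = (\<lambda>i. (k * lca_pattern m c v n a t i) mod int n)"
proof (induction t)
  case 0
  show ?case
    by (auto simp: lca_pattern_def single_site_seed_def)
next
  case (Suc t)
  then show ?case
    by (simp add: lca_pattern_def lca_step_mult)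
qed

text \<open>Every step ends with a reduction modulo \<open>n\<close>; only time 0 shows the seed
  unreduced, hence the assumption on \<open>a\<close>.\<close>

lemma lca_pattern_in_carrier:
  assumes "a \<in> carrier (integer_mod_group n)"
  shows "lca_pattern m c v n a t i \<in> carrier (integer_mod_group n)"
proof (cases t)
  case 0
  then show ?thesis
    using assms by (simp add: lca_pattern_def single_site_seed_def)
next
  case (Suc s)
  then show ?thesis
    by (simp add: lca_pattern_def lca_step_def carrier_integer_mod_group)
qed

text \<open>As a plain image, the value set can be carried along a map by composing
  functions.\<close>

lemma pattern_values_eq_image:
  assumes "a \<in> carrier (integer_mod_group n)"
  shows "pattern_values m c v n a = (\<lambda>(i, t). lca_pattern m c v n a t i) ` UNIV"
  using lca_pattern_in_carrier [OF assms] by (fastforce simp: pattern_values_def)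

text \<open>With \<open>x\<close> inverse to \<open>a\<close>, each residue \<open>b\<close> is the
  multiple \<open>(b * x) * a\<close>. Thus the isomorphism between the subgroups of two unit seeds
  is just an automorphism of the whole group.\<close>

lemma subgroup_generated_coprime:
  assumes "n > 0" and "a \<in> carrier (integer_mod_group n)" and "coprime a (int n)"
  shows "carrier (subgroup_generated (integer_mod_group n) {a}) = carrier (integer_mod_group n)"
proof -
  obtain x where x: "[a * x = 1] (mod int n)"
    using assms(3) cong_solve_coprime_int by blast
  have "b \<in> range (\<lambda>k. (k * a) mod int n)" if "b \<in> {0..<int n}" for b
  proof
    have "[b * x * a = b] (mod int n)"
      using cong_scalar_left [OF x, of b] by (simp add: mult_ac)
    then show "b = (b * x * a) mod int n"
      using that by (simp add: cong_def)
  qed simp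
  moreover have "range (\<lambda>k. (k * a) mod int n) \<subseteq> {0..<int n}"
    using assms(1) by auto
  ultimately show ?thesis
    using assms(1) group.carrier_subgroup_generated_by_singleton [OF group_integer_mod_group assms(2)]
    by (auto simp: int_pow_integer_mod_group carrier_integer_mod_group)
qed

lemma bij_betw_mult_mod:
  assumes "[k * l = 1] (mod int n)" and "n > 0"
  shows "bij_betw (\<lambda>x. (k * x) mod int n) {0..<int n} {0..<int n}"
proof (rule bij_betw_byWitness [where f' = "\<lambda>x. (l * x) mod int n"])
  \<comment> \<open>Since \<open>k * (l * x) = l * (k * x)\<close>, this settles both
    composites.\<close>
  have "(k * (l * x)) mod int n = x" if "x \<in> {0..<int n}" for x
    using cong_scalar_right [OF assms(1), of x] that by (simp add: cong_def mult_ac)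
  then show "\<forall>x\<in>{0..<int n}. (k * ((l * x) mod int n)) mod int n = x"
    and "\<forall>x\<in>{0..<int n}. (l * ((k * x) mod int n)) mod int n = x"
    by (simp_all add: mod_mult_right_eq mult.left_commute)
qed (use assms(2) in auto)

theorem lemma2:
  fixes q m :: nat
    and c :: "nat \<Rightarrow> int"
    and v :: "nat \<Rightarrow> int ^ 'd::finite"
    and a a' :: int
  assumes "q > 1" and "\<not> prime q"
    and "m > 0"
    and "a \<in> carrier (integer_mod_group q)" and "coprime a (int q)"
    and "a' \<in> carrier (integer_mod_group q)" and "coprime a' (int q)"
  shows "isomorphic_patterns m c v q a q a'"
proof -
  let ?G = "integer_mod_group q"
  have q: "q > 0" and carrier: "carrier ?G = {0..<int q}"
    using assms(1) by (auto simp: carrier_integer_mod_group)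
  obtain x y where x: "[a * x = 1] (mod int q)" and y: "[a' * y = 1] (mod int q)"
    using assms(5,7) cong_solve_coprime_int by meson
  \<comment> \<open>The quotient of \<open>a'\<close> by \<open>a\<close>; its inverse modulo
    \<open>q\<close> is \<open>a * y\<close>.\<close>
  define k where "k = a' * x"
  define f where "f = (\<lambda>b. (k * b) mod int q)"
  have "[k * (a * y) = 1] (mod int q)"
    using cong_mult [OF x y] by (simp add: k_def mult_ac)
  then have bij: "bij_betw f (carrier ?G) (carrier ?G)"
    unfolding f_def carrier using q by (rule bij_betw_mult_mod)
  have "[k * a = a'] (mod int q)"
    using cong_scalar_left [OF x, of a'] by (simp add: k_def mult_ac)
  \<comment> \<open>The congruence becomes an equality because \<open>a'\<close> is the
    representative in \<open>{0..<int q}\<close>.\<close>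
  then have ka: "(k * a) mod int q = a'"
    using assms(6) by (simp add: cong_def carrier)
  have pattern: "f (lca_pattern m c v q a t i) = lca_pattern m c v q a' t i" for i t
    using lca_pattern_mult [of m c v q k a t] by (simp add: ka f_def)
  have "pattern_values m c v q a' = f ` pattern_values m c v q a"
    by (simp add: pattern_values_eq_image assms(4,6) image_image case_prod_beta pattern)
  moreover have "pattern_values m c v q a \<subseteq> carrier ?G"
    by (auto simp: pattern_values_def)
  ultimately have "bij_betw f (pattern_values m c v q a) (pattern_values m c v q a')"
    using bij by (metis bij_betw_subset)
  \<comment> \<open>Both subgroups are all of \<open>?G\<close>, so \<open>f\<close> itself serves
    as the group isomorphism that it has to restrict.\<close>
  moreover have "f \<in> iso (subgroup_generated ?G {a}) (subgroup_generated ?G {a'})"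
    using bij bij_betwE [OF bij] subgroup_generated_coprime [OF q] assms(4-7)
    by (auto simp: iso_def hom_def f_def mod_simps distrib_left)
  ultimately show ?thesis
    unfolding isomorphic_patterns_def using pattern by blast
qed

end
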